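(* Let $(\Omega,\Sigma,P)$ be a probability space and let $E$ be a sequentially separable locally convex space. Then the maps \[ \bar\kappa: L^0(\Omega\!:\!E')\to\mathcal{L}_{\rm c}(E\!:\!L^0(\Omega))\quad\text{and}\quad \kappa_2: L^0(\Omega\!:\!E')\to\mathcal{L}(E\!:\!L^0(\Omega))_{\rm path}, \] both given by $[X]\mapsto\big(e\mapsto[\omega\mapsto X(\omega)(e)]\big)$, are injective.
   Context: A locally convex space means a Hausdorff locally convex topological vector space over $\mathbb{R}$. It is sequentially separable if it has a countable subset $D$ such that every element of $E$ is the limit of a sequence of elements of $D$. $E'$ denotes the space of sequentially continuous linear maps $E\to\mathbb{R}$. $L^0(\Omega)$ is the space of real-valued measurable functions on $\Omega$ modulo $P$-almost sure equality, with the topology of convergence in probability. $\mathcal{L}_{\rm c}(E\!:\!L^0(\Omega))$ is the space of sequentially continuous linear maps $E\to L^0(\Omega)$. $\mathcal{L}(E\!:\!L^0(\Omega))_{\rm path}$ is the space of linear maps $Y:E\to L^0(\Omega)$ such that $e_n\to e$ in $E$ implies $Y(e_n)\to Y(e)$ almost surely (the exceptional null set may depend on the sequence and on $e$); it is a subspace of $\mathcal{L}_{\rm c}(E\!:\!L^0(\Omega))$. $E'$ carries the restriction of the Kolmogorov $\sigma$-algebra of $\mathbb{R}^E$, i.e. the $\sigma$-algebra generated by the evaluations $T\mapsto T(e)$, $e\in E$; thus $X:\Omega\to E'$ is measurable iff $\omega\mapsto X(\omega)(e)$ is measurable for every $e\in E$. $L^0(\Omega\!:\!E')$ is the space of measurable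 maps $\Omega\to E'$ modulo strict equivalence: $X_1,X_2$ are identified iff there is a set $\Omega_1\subset\Omega$ with $P(\Omega_1)=1$ and $X_1(\omega)=X_2(\omega)$ in $E'$ for all $\omega\in\Omega_1$. The maps $\bar\kappa$ and $\kappa_2$ are well defined on equivalence classes. *)

theory Defs
  imports "HOL-Probability.Probability"
begin

text \<open>The clause on \<open>u\<close> and \<open>v\<close> is \<^term>\<open>convex V\<close> unfolded; the constant itself has a sort
  constraint that prevents its use in a class specification.\<close>

class locally_convex_space = real_vector + t2_space + topological_ab_group_add +
  assumes tendsto_scaleR_Pair:
    "LIM x (nhds a \<times>\<^sub>F nhds b). fst x *\<^sub>R snd x :> nhds (a *\<^sub>R b)"
  assumes convex_nhds_base_0:
    "open U \<Longrightarrow> 0 \<in> U \<Longrightarrow> \<exists>V. open V \<and> 0 \<in> V \<and> V \<subseteq> U \<and>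
       (\<forall>x\<in>V. \<forall>y\<in>V. \<forall>u\<ge>0. \<forall>v\<ge>0. u + v = 1 \<longrightarrow> u *\<^sub>R x + v *\<^sub>R y \<in> V)"

lemma locally_convex_at_0:
  fixes U :: "'e::locally_convex_space set"
  assumes "open U" "0 \<in> U"
  obtains V where "open V" "convex V" "0 \<in> V" "V \<subseteq> U"
  using convex_nhds_base_0[OF assms] unfolding convex_def by blast

definition sequentially_separable :: "'e::topological_space itself \<Rightarrow> bool" where
  "sequentially_separable _ \<longleftrightarrow>
     (\<exists>D :: 'e set. countable D \<and> (\<forall>x. \<exists>d :: nat \<Rightarrow> 'e. range d \<subseteq> D \<and> d \<longlonglongrightarrow> x))"

definition seq_dual :: "('e::locally_convex_space \<Rightarrow> real) set" where
  "seq_dual = {T. linear T \<and> (\<forall>x l. x \<longlonglongrightarrow> l \<longrightarrow> (\<lambda>n. T (x n)) \<longlonglongrightarrow> T l)}"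

definition seq_dual_measure :: "('e::locally_convex_space \<Rightarrow> real) measure" where
  "seq_dual_measure = restrict_space (\<Pi>\<^sub>M e\<in>UNIV. borel) seq_dual"


text \<open>Elements of \<open>L0 M\<close> are equivalence classes, so its vector space operations and its topology
  are explicit constants rather than type class operations.\<close>

definition L0_rel :: "'w measure \<Rightarrow> (('w \<Rightarrow> real) \<times> ('w \<Rightarrow> real)) set" where
  "L0_rel M = {(f, g). f \<in> borel_measurable M \<and> g \<in> borel_measurable M \<and> (AE \<omega> in M. f \<omega> = g \<omega>)}"

definition L0 :: "'w measure \<Rightarrow> ('w \<Rightarrow> real) set set" where
  "L0 M = borel_measurable M // L0_rel M"

definition L0_class :: "'w measure \<Rightarrow> ('w \<Rightarrow> real) \<Rightarrow> ('w \<Rightarrow> real) set" where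
  "L0_class M f = L0_rel M `` {f}"

definition L0_add :: "'w measure \<Rightarrow> ('w \<Rightarrow> real) set \<Rightarrow> ('w \<Rightarrow> real) set \<Rightarrow> ('w \<Rightarrow> real) set" where
  "L0_add M A B = (\<Union>f\<in>A. \<Union>g\<in>B. L0_class M (\<lambda>\<omega>. f \<omega> + g \<omega>))"

definition L0_scale :: "'w measure \<Rightarrow> real \<Rightarrow> ('w \<Rightarrow> real) set \<Rightarrow> ('w \<Rightarrow> real) set" where
  "L0_scale M c A = (\<Union>f\<in>A. L0_class M (\<lambda>\<omega>. c * f \<omega>))"

text \<open>The sets \<open>L0_nbhd M \<epsilon> A\<close> form a neighbourhood base at \<open>A\<close> for convergence in probability;
  which representatives are chosen is irrelevant.\<close>

definition L0_nbhd :: "'w measure \<Rightarrow> real \<Rightarrow> ('w \<Rightarrow> real) set \<Rightarrow> ('w \<Rightarrow> real) set set" where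
  "L0_nbhd M \<epsilon> A =
     {B \<in> L0 M. \<exists>f\<in>A. \<exists>g\<in>B. measure M {\<omega> \<in> space M. \<epsilon> < \<bar>f \<omega> - g \<omega>\<bar>} < \<epsilon>}"

definition L0_topology :: "'w measure \<Rightarrow> ('w \<Rightarrow> real) set topology" where
  "L0_topology M = topology (\<lambda>U. U \<subseteq> L0 M \<and> (\<forall>A\<in>U. \<exists>\<epsilon>>0. L0_nbhd M \<epsilon> A \<subseteq> U))"

definition L0_tendsto_AE ::
    "'w measure \<Rightarrow> (nat \<Rightarrow> ('w \<Rightarrow> real) set) \<Rightarrow> ('w \<Rightarrow> real) set \<Rightarrow> bool" where
  "L0_tendsto_AE M A B \<longleftrightarrow>
     (\<forall>f g. (\<forall>n. f n \<in> A n) \<longrightarrow> g \<in> B \<longrightarrow> (AE \<omega> in M. (\<lambda>n. f n \<omega>) \<longlonglongrightarrow> g \<omega>))"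

definition L0_linear :: "'w measure \<Rightarrow> ('e::real_vector \<Rightarrow> ('w \<Rightarrow> real) set) \<Rightarrow> bool" where
  "L0_linear M Y \<longleftrightarrow>
     (\<forall>x. Y x \<in> L0 M) \<and>
     (\<forall>x y. Y (x + y) = L0_add M (Y x) (Y y)) \<and>
     (\<forall>c x. Y (c *\<^sub>R x) = L0_scale M c (Y x))"

definition Lin_c :: "'w measure \<Rightarrow> ('e::locally_convex_space \<Rightarrow> ('w \<Rightarrow> real) set) set" where
  "Lin_c M = {Y. L0_linear M Y \<and>
     (\<forall>x l. x \<longlonglongrightarrow> l \<longrightarrow> limitin (L0_topology M) (\<lambda>n. Y (x n)) (Y l) sequentially)}"

definition Lin_path :: "'w measure \<Rightarrow> ('e::locally_convex_space \<Rightarrow> ('w \<Rightarrow> real) set) set" where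
  "Lin_path M = {Y. L0_linear M Y \<and>
     (\<forall>x l. x \<longlonglongrightarrow> l \<longrightarrow> L0_tendsto_AE M (\<lambda>n. Y (x n)) (Y l))}"


definition strict_rel ::
    "'w measure \<Rightarrow> (('w \<Rightarrow> 'e::locally_convex_space \<Rightarrow> real) \<times> ('w \<Rightarrow> 'e \<Rightarrow> real)) set" where
  "strict_rel M = {(X, Y). X \<in> M \<rightarrow>\<^sub>M seq_dual_measure \<and> Y \<in> M \<rightarrow>\<^sub>M seq_dual_measure \<and>
     (\<exists>\<Omega>\<^sub>1\<in>sets M. measure M \<Omega>\<^sub>1 = 1 \<and> (\<forall>\<omega>\<in>\<Omega>\<^sub>1. X \<omega> = Y \<omega>))}"

definition L0_dual :: "'w measure \<Rightarrow> ('w \<Rightarrow> 'e::locally_convex_space \<Rightarrow> real) set set" where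
  "L0_dual M = (M \<rightarrow>\<^sub>M seq_dual_measure) // strict_rel M"

text \<open>All representatives of a class in \<open>L0_dual M\<close> yield the same class in \<open>L0 M\<close>, so the union
  below has a single distinct member; see \<open>kappa_class\<close>. The maps into \<open>Lin_c M\<close> and into
  \<open>Lin_path M\<close> differ only in their codomain.\<close>

definition kappa ::
    "'w measure \<Rightarrow> ('w \<Rightarrow> 'e::locally_convex_space \<Rightarrow> real) set \<Rightarrow> 'e \<Rightarrow> ('w \<Rightarrow> real) set" where
  "kappa M C = (\<lambda>e. \<Union>X\<in>C. L0_class M (\<lambda>\<omega>. X \<omega> e))"


lemma measurable_seq_dual_measure_iff:
  "X \<in> M \<rightarrow>\<^sub>M seq_dual_measure \<longleftrightarrow>
     (\<forall>\<omega>\<in>space M. X \<omega> \<in> seq_dual) \<and> (\<forall>e. (\<lambda>\<omega>. X \<omega> e) \<in> borel_measurable M)"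
proof -
  have "X \<in> M \<rightarrow>\<^sub>M (\<Pi>\<^sub>M e\<in>UNIV. borel) \<longleftrightarrow> (\<forall>e. (\<lambda>\<omega>. X \<omega> e) \<in> borel_measurable M)"
  proof
    assume "X \<in> M \<rightarrow>\<^sub>M (\<Pi>\<^sub>M e\<in>UNIV. borel)"
    then show "\<forall>e. (\<lambda>\<omega>. X \<omega> e) \<in> borel_measurable M"
      by (auto intro!: measurable_compose[OF _ measurable_component_singleton])
  next
    assume "\<forall>e. (\<lambda>\<omega>. X \<omega> e) \<in> borel_measurable M"
    then show "X \<in> M \<rightarrow>\<^sub>M (\<Pi>\<^sub>M e\<in>UNIV. borel)"
      by (intro measurable_PiM_single') (auto simp: PiE_def)
  qed
  then show ?thesis
    unfolding seq_dual_measure_def by (auto simp: measurable_restrict_space2_iff)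
qed

lemma equiv_L0_rel: "equiv (borel_measurable M) (L0_rel M)"
proof (rule equivI)
  show "L0_rel M \<subseteq> borel_measurable M \<times> borel_measurable M" by (auto simp: L0_rel_def)
  show "refl_on (borel_measurable M) (L0_rel M)" by (auto simp: refl_on_def L0_rel_def)
  show "sym (L0_rel M)" by (auto simp: sym_def L0_rel_def)
  show "trans (L0_rel M)"
  proof (rule transI)
    fix f g h assume "(f, g) \<in> L0_rel M" "(g, h) \<in> L0_rel M"
    then show "(f, h) \<in> L0_rel M" by (auto simp: L0_rel_def)
  qed
qed

lemma L0_class_in_L0: "f \<in> borel_measurable M \<Longrightarrow> L0_class M f \<in> L0 M"
  by (simp add: L0_class_def L0_def quotientI)

lemma self_in_L0_class: "f \<in> borel_measurable M \<Longrightarrow> f \<in> L0_class M f"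
  by (simp add: L0_class_def L0_rel_def)

lemma mem_L0_class: 
  "f \<in> L0_class M g \<longleftrightarrow> f \<in> borel_measurable M \<and> g \<in> borel_measurable M \<and> (AE \<omega> in M. g \<omega> = f \<omega>)"
  by (auto simp: L0_class_def L0_rel_def)

lemma L0_classE:
  assumes "A \<in> L0 M"
  obtains f where "f \<in> borel_measurable M" "A = L0_class M f"
  using assms by (auto simp: L0_def L0_class_def elim!: quotientE)

lemma L0_class_eq_iff:
  assumes "f \<in> borel_measurable M" "g \<in> borel_measurable M"
  shows "L0_class M f = L0_class M g \<longleftrightarrow> (AE \<omega> in M. f \<omega> = g \<omega>)"
  using eq_equiv_class_iff[OF equiv_L0_rel, of f M g] assms
  by (auto simp: L0_class_def L0_rel_def)

lemma L0_add_class: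
  assumes "f \<in> borel_measurable M" "g \<in> borel_measurable M"
  shows "L0_add M (L0_class M f) (L0_class M g) = L0_class M (\<lambda>\<omega>. f \<omega> + g \<omega>)"
proof -
  have "L0_class M (\<lambda>\<omega>. f' \<omega> + g' \<omega>) = L0_class M (\<lambda>\<omega>. f \<omega> + g \<omega>)"
    if "f' \<in> L0_class M f" "g' \<in> L0_class M g" for f' g'
    using that by (subst L0_class_eq_iff) (auto simp: mem_L0_class)
  then have "L0_add M (L0_class M f) (L0_class M g) =
      (\<Union>f'\<in>L0_class M f. \<Union>g'\<in>L0_class M g. L0_class M (\<lambda>\<omega>. f \<omega> + g \<omega>))"
    unfolding L0_add_def by (intro SUP_cong) auto
  with self_in_L0_class[OF assms(1)] self_in_L0_class[OF assms(2)] show ?thesis by auto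
qed

lemma L0_scale_class:
  assumes "f \<in> borel_measurable M"
  shows "L0_scale M c (L0_class M f) = L0_class M (\<lambda>\<omega>. c * f \<omega>)"
proof -
  have "L0_class M (\<lambda>\<omega>. c * f' \<omega>) = L0_class M (\<lambda>\<omega>. c * f \<omega>)"
    if "f' \<in> L0_class M f" for f'
  proof -
    from that have f': "f' \<in> borel_measurable M" and ae: "AE \<omega> in M. f \<omega> = f' \<omega>"
      by (auto simp: mem_L0_class)
    from ae have "AE \<omega> in M. c * f' \<omega> = c * f \<omega>" by eventually_elim simp
    then show ?thesis using f' assms by (subst L0_class_eq_iff) auto
  qed
  then have "L0_scale M c (L0_class M f) =
      (\<Union>f'\<in>L0_class M f. L0_class M (\<lambda>\<omega>. c * f \<omega>))"
    unfolding L0_scale_def by (intro SUP_cong) auto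
  with self_in_L0_class[OF assms] show ?thesis by auto
qed

lemma (in prob_space) equiv_strict_rel:
  "equiv (M \<rightarrow>\<^sub>M seq_dual_measure)
     (strict_rel M :: (('a \<Rightarrow> 'e::locally_convex_space \<Rightarrow> real) \<times> _) set)" (is "equiv ?A ?r")
proof (rule equivI)
  show "?r \<subseteq> ?A \<times> ?A"
    by (auto simp: strict_rel_def)
  show "refl_on ?A ?r"
    by (auto simp: refl_on_def strict_rel_def intro!: bexI[of _ "space M"] prob_space)
  show "sym ?r" by (fastforce simp: sym_def strict_rel_def)
  show "trans ?r"
  proof (rule transI)
    fix X Y Z :: "'a \<Rightarrow> 'e \<Rightarrow> real"
    assume "(X, Y) \<in> strict_rel M" "(Y, Z) \<in> strict_rel M"
    then obtain S T where S: "S \<in> sets M" "prob S = 1" "\<forall>\<omega>\<in>S. X \<omega> = Y \<omega>"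
      and T: "T \<in> sets M" "prob T = 1" "\<forall>\<omega>\<in>T. Y \<omega> = Z \<omega>"
      and meas: "X \<in> M \<rightarrow>\<^sub>M seq_dual_measure" "Z \<in> M \<rightarrow>\<^sub>M seq_dual_measure"
      unfolding strict_rel_def by blast
    have "prob (S \<inter> T) = 1"
      using S T by (simp add: measure_space_inter prob_space)
    then show "(X, Z) \<in> strict_rel M"
      using S T meas by (auto simp: strict_rel_def intro!: bexI[of _ "S \<inter> T"])
  qed
qed

lemma (in prob_space) kappa_class:
  assumes "X \<in> M \<rightarrow>\<^sub>M seq_dual_measure"
  shows "kappa M (strict_rel M `` {X}) = (\<lambda>e. L0_class M (\<lambda>\<omega>. X \<omega> e))"
proof
  fix e
  have eq: "L0_class M (\<lambda>\<omega>. Y \<omega> e) = L0_class M (\<lambda>\<omega>. X \<omega> e)"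
    if "Y \<in> strict_rel M `` {X}" for Y
  proof -
    from that obtain S where S: "S \<in> sets M" "prob S = 1" "\<forall>\<omega>\<in>S. X \<omega> = Y \<omega>"
      and Y: "Y \<in> M \<rightarrow>\<^sub>M seq_dual_measure"
      unfolding strict_rel_def by blast
    have "AE \<omega> in M. \<omega> \<in> S" using S by (simp add: prob_eq_1)
    then have "AE \<omega> in M. Y \<omega> e = X \<omega> e" by eventually_elim (use S in simp)
    then show ?thesis
      using Y assms by (subst L0_class_eq_iff) (auto simp: measurable_seq_dual_measure_iff)
  qed
  have "X \<in> strict_rel M `` {X}"
    using equiv_class_self[OF equiv_strict_rel assms] .
  moreover have "kappa M (strict_rel M `` {X}) e =
      (\<Union>Y\<in>strict_rel M `` {X}. L0_class M (\<lambda>\<omega>. X \<omega> e))"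
    unfolding kappa_def by (intro SUP_cong refl eq)
  ultimately show "kappa M (strict_rel M `` {X}) e = L0_class M (\<lambda>\<omega>. X \<omega> e)" by auto
qed

lemma (in prob_space) L0_nbhd_class:
  assumes "f \<in> borel_measurable M" "g \<in> borel_measurable M"
  shows "L0_class M g \<in> L0_nbhd M \<epsilon> (L0_class M f) \<longleftrightarrow>
    prob {\<omega> \<in> space M. \<epsilon> < \<bar>f \<omega> - g \<omega>\<bar>} < \<epsilon>"
proof -
  have "prob {\<omega> \<in> space M. \<epsilon> < \<bar>f' \<omega> - g' \<omega>\<bar>} = prob {\<omega> \<in> space M. \<epsilon> < \<bar>f \<omega> - g \<omega>\<bar>}"
    if "f' \<in> L0_class M f" "g' \<in> L0_class M g" for f' g'
  proof (rule finite_measure_eq_AE)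
    have *[measurable]: "f' \<in> borel_measurable M" "g' \<in> borel_measurable M"
      "f \<in> borel_measurable M" "g \<in> borel_measurable M"
      and ae: "AE \<omega> in M. f \<omega> = f' \<omega>" "AE \<omega> in M. g \<omega> = g' \<omega>"
      using that assms by (auto simp: mem_L0_class)
    show "AE x in M. (x \<in> {\<omega> \<in> space M. \<epsilon> < \<bar>f' \<omega> - g' \<omega>\<bar>})
        = (x \<in> {\<omega> \<in> space M. \<epsilon> < \<bar>f \<omega> - g \<omega>\<bar>})"
      using ae by eventually_elim simp
    show "{\<omega> \<in> space M. \<epsilon> < \<bar>f' \<omega> - g' \<omega>\<bar>} \<in> sets M" by measurable
    show "{\<omega> \<in> space M. \<epsilon> < \<bar>f \<omega> - g \<omega>\<bar>} \<in> sets M" by measurable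
  qed
  then have "(\<exists>f'\<in>L0_class M f. \<exists>g'\<in>L0_class M g.
        prob {\<omega> \<in> space M. \<epsilon> < \<bar>f' \<omega> - g' \<omega>\<bar>} < \<epsilon>) \<longleftrightarrow>
      (\<exists>f'\<in>L0_class M f. \<exists>g'\<in>L0_class M g. prob {\<omega> \<in> space M. \<epsilon> < \<bar>f \<omega> - g \<omega>\<bar>} < \<epsilon>)"
    by (intro bex_cong refl) simp
  also have "\<dots> \<longleftrightarrow> prob {\<omega> \<in> space M. \<epsilon> < \<bar>f \<omega> - g \<omega>\<bar>} < \<epsilon>"
    using self_in_L0_class[OF assms(1)] self_in_L0_class[OF assms(2)] by auto
  finally show ?thesis
    unfolding L0_nbhd_def using L0_class_in_L0[OF assms(2)] by simp
qed

lemma (in prob_space) L0_nbhd_mono: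
  assumes "\<delta> \<le> \<epsilon>" "A \<in> L0 M" 
  shows "L0_nbhd M \<delta> A \<subseteq> L0_nbhd M \<epsilon> A"
proof
  fix B assume B: "B \<in> L0_nbhd M \<delta> A"
  obtain f where f: "f \<in> borel_measurable M" "A = L0_class M f" using assms L0_classE by blast
  obtain g where g: "g \<in> borel_measurable M" "B = L0_class M g"
    using B L0_classE unfolding L0_nbhd_def by blast
  note [measurable] = f(1) g(1)
  have "prob {\<omega> \<in> space M. \<epsilon> < \<bar>f \<omega> - g \<omega>\<bar>} \<le> prob {\<omega> \<in> space M. \<delta> < \<bar>f \<omega> - g \<omega>\<bar>}"
    using assms by (intro finite_measure_mono) auto
  moreover have "prob {\<omega> \<in> space M. \<delta> < \<bar>f \<omega> - g \<omega>\<bar>} < \<delta>"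
    using B L0_nbhd_class f g by blast
  ultimately show "B \<in> L0_nbhd M \<epsilon> A"
    using assms L0_nbhd_class f g by force
qed

lemma (in prob_space) openin_L0_topology:
  "openin (L0_topology M) U \<longleftrightarrow> U \<subseteq> L0 M \<and> (\<forall>A\<in>U. \<exists>\<epsilon>>0. L0_nbhd M \<epsilon> A \<subseteq> U)"
proof -
  have "istopology (\<lambda>U. U \<subseteq> L0 M \<and> (\<forall>A\<in>U. \<exists>\<epsilon>>0. L0_nbhd M \<epsilon> A \<subseteq> U))"
    unfolding istopology_def
  proof (intro conjI allI impI)
    fix S T :: "('a \<Rightarrow> real) set set"
    assume S: "S \<subseteq> L0 M \<and> (\<forall>A\<in>S. \<exists>\<epsilon>>0. L0_nbhd M \<epsilon> A \<subseteq> S)"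
      and T: "T \<subseteq> L0 M \<and> (\<forall>A\<in>T. \<exists>\<epsilon>>0. L0_nbhd M \<epsilon> A \<subseteq> T)"
    show "S \<inter> T \<subseteq> L0 M" using S by blast
    show "\<forall>A\<in>S \<inter> T. \<exists>\<epsilon>>0. L0_nbhd M \<epsilon> A \<subseteq> S \<inter> T"
    proof
      fix A assume A: "A \<in> S \<inter> T"
      then obtain s t where st: "s > 0" "L0_nbhd M s A \<subseteq> S" "t > 0" "L0_nbhd M t A \<subseteq> T"
        using S T by blast
      have "A \<in> L0 M" using A S by blast
      then have "L0_nbhd M (min s t) A \<subseteq> S \<inter> T"
        using st L0_nbhd_mono[of "min s t" s A] L0_nbhd_mono[of "min s t" t A] by auto
      then show "\<exists>\<epsilon>>0. L0_nbhd M \<epsilon> A \<subseteq> S \<inter> T"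
        using st by (intro exI[of _ "min s t"]) auto
    qed
  next
    fix K :: "('a \<Rightarrow> real) set set set"
    assume K: "\<forall>S\<in>K. S \<subseteq> L0 M \<and> (\<forall>A\<in>S. \<exists>\<epsilon>>0. L0_nbhd M \<epsilon> A \<subseteq> S)"
    show "\<Union> K \<subseteq> L0 M" using K by blast
    show "\<forall>A\<in>\<Union> K. \<exists>\<epsilon>>0. L0_nbhd M \<epsilon> A \<subseteq> \<Union> K"
    proof
      fix A assume "A \<in> \<Union> K"
      then obtain S where S: "S \<in> K" "A \<in> S" by blast
      with K obtain \<epsilon> where "\<epsilon> > 0" "L0_nbhd M \<epsilon> A \<subseteq> S" by blast
      with S show "\<exists>\<epsilon>>0. L0_nbhd M \<epsilon> A \<subseteq> \<Union> K" by blast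
    qed
  qed
  then show ?thesis by (simp add: L0_topology_def topology_inverse')
qed

lemma (in prob_space) topspace_L0_topology: "topspace (L0_topology M) = L0 M"
proof -
  have "openin (L0_topology M) (L0 M)"
    unfolding openin_L0_topology
    by (auto simp: L0_nbhd_def intro!: exI[of _ "1::real"])
  then show ?thesis
    by (metis openin_L0_topology openin_subset openin_topspace subset_antisym)
qed

lemma (in prob_space) limitin_L0_topology_iff:
  fixes f :: "nat \<Rightarrow> 'a \<Rightarrow> real" and g :: "'a \<Rightarrow> real"
  assumes f: "\<And>n. f n \<in> borel_measurable M" and g: "g \<in> borel_measurable M"
  shows "limitin (L0_topology M) (\<lambda>n. L0_class M (f n)) (L0_class M g) sequentially \<longleftrightarrow>
    (\<forall>\<epsilon>>0. (\<lambda>n. prob {\<omega> \<in> space M. \<epsilon> < \<bar>f n \<omega> - g \<omega>\<bar>}) \<longlonglongrightarrow> 0)"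
    (is "?lim \<longleftrightarrow> ?prob")
proof
  note [measurable] = f g
  assume R: ?prob
  show ?lim unfolding limitin_def
  proof (intro conjI allI impI)
    show "L0_class M g \<in> topspace (L0_topology M)"
      using g by (simp add: topspace_L0_topology L0_class_in_L0)
    fix U assume U: "openin (L0_topology M) U \<and> L0_class M g \<in> U"
    then obtain \<epsilon> where e: "\<epsilon> > 0" "L0_nbhd M \<epsilon> (L0_class M g) \<subseteq> U"
      unfolding openin_L0_topology by blast
    have "eventually (\<lambda>n. prob {\<omega> \<in> space M. \<epsilon> < \<bar>f n \<omega> - g \<omega>\<bar>} < \<epsilon>) sequentially"
      using R e by (auto intro: order_tendstoD)
    then show "\<forall>\<^sub>F n in sequentially. L0_class M (f n) \<in> U"
    proof eventually_elim
      case (elim n)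
      then have "L0_class M (f n) \<in> L0_nbhd M \<epsilon> (L0_class M g)"
        by (subst L0_nbhd_class) (auto simp: abs_minus_commute)
      then show ?case using e by blast
    qed
  qed
next
  note [measurable] = f g
  assume L: ?lim
  show ?prob
  proof (intro allI impI)
    fix \<epsilon> :: real assume \<epsilon>: "\<epsilon> > 0"
    show "(\<lambda>n. prob {\<omega> \<in> space M. \<epsilon> < \<bar>f n \<omega> - g \<omega>\<bar>}) \<longlonglongrightarrow> 0"
    proof (rule order_tendstoI)
      fix a :: real assume "a < 0"
      then show "\<forall>\<^sub>F n in sequentially. a < prob {\<omega> \<in> space M. \<epsilon> < \<bar>f n \<omega> - g \<omega>\<bar>}"
        by (auto intro!: always_eventually intro: less_le_trans)
    next
      fix a :: real assume a: "0 < a"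
      define \<eta> where "\<eta> = min a \<epsilon>"
      have \<eta>: "\<eta> > 0" "\<eta> \<le> a" "\<eta> \<le> \<epsilon>" using a \<epsilon> by (auto simp: \<eta>_def)
      define U where "U = (\<Union>\<delta>\<in>{0<..<\<eta>}. L0_nbhd M \<delta> (L0_class M g))"
      have "openin (L0_topology M) U"
        unfolding openin_L0_topology
      proof (intro conjI ballI)
        show "U \<subseteq> L0 M" by (auto simp: U_def L0_nbhd_def)
        fix A assume A: "A \<in> U"
        then obtain \<delta> where d: "0 < \<delta>" "\<delta> < \<eta>" "A \<in> L0_nbhd M \<delta> (L0_class M g)"
          by (auto simp: U_def)
        obtain h where h[measurable]: "h \<in> borel_measurable M" and Ah: "A = L0_class M h"
          using d L0_classE unfolding L0_nbhd_def by blast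
        define r where "r = (\<eta> - \<delta>) / 2"
        have r: "r > 0" "\<delta> + r < \<eta>" using d by (auto simp: r_def field_simps)
        have "L0_nbhd M r A \<subseteq> U"
        proof
          fix B assume B: "B \<in> L0_nbhd M r A"
          obtain k where k[measurable]: "k \<in> borel_measurable M" and Bk: "B = L0_class M k"
            using B L0_classE unfolding L0_nbhd_def by blast
          have "prob {\<omega> \<in> space M. \<delta> + r < \<bar>g \<omega> - k \<omega>\<bar>} \<le>
              prob ({\<omega> \<in> space M. \<delta> < \<bar>g \<omega> - h \<omega>\<bar>} \<union> {\<omega> \<in> space M. r < \<bar>h \<omega> - k \<omega>\<bar>})"
            by (intro finite_measure_mono) auto
          also have "\<dots> \<le> prob {\<omega> \<in> space M. \<delta> < \<bar>g \<omega> - h \<omega>\<bar>}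
              + prob {\<omega> \<in> space M. r < \<bar>h \<omega> - k \<omega>\<bar>}"
            by (intro measure_Un_le) auto
          also have "\<dots> < \<delta> + r"
            using d(3) B unfolding Ah Bk
            by (subst (asm) (1 2) L0_nbhd_class) (auto intro: add_strict_mono)
          finally have "B \<in> L0_nbhd M (\<delta> + r) (L0_class M g)"
            unfolding Bk by (subst L0_nbhd_class) auto
          then show "B \<in> U" using r d by (auto simp: U_def intro!: bexI[of _ "\<delta> + r"])
        qed
        then show "\<exists>\<epsilon>>0. L0_nbhd M \<epsilon> A \<subseteq> U" using r by blast
      qed
      moreover have "L0_class M g \<in> U"
      proof -
        have "L0_class M g \<in> L0_nbhd M (\<eta> / 2) (L0_class M g)"
          using \<eta> by (subst L0_nbhd_class) auto
        then show ?thesis using \<eta> by (auto simp: U_def intro!: bexI[of _ "\<eta> / 2"])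
      qed
      ultimately have "\<forall>\<^sub>F n in sequentially. L0_class M (f n) \<in> U"
        using L by (auto simp: limitin_def)
      then show "\<forall>\<^sub>F n in sequentially. prob {\<omega> \<in> space M. \<epsilon> < \<bar>f n \<omega> - g \<omega>\<bar>} < a"
      proof eventually_elim
        case (elim n)
        then obtain \<delta> where d: "0 < \<delta>" "\<delta> < \<eta>" "L0_class M (f n) \<in> L0_nbhd M \<delta> (L0_class M g)"
          by (auto simp: U_def)
        have "prob {\<omega> \<in> space M. \<epsilon> < \<bar>f n \<omega> - g \<omega>\<bar>} \<le> prob {\<omega> \<in> space M. \<delta> < \<bar>g \<omega> - f n \<omega>\<bar>}"
          using d \<eta> by (intro finite_measure_mono) auto
        also have "\<dots> < \<delta>" using d(3) by (subst (asm) L0_nbhd_class) auto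
        finally show ?case using d \<eta> by linarith
      qed
    qed
  qed
qed

end

theory Submission
  imports Defs
begin

text \<open>Let \<open>X\<close> be a random variable with values in \<open>seq_dual\<close>. Pointwise in
  \<open>\<omega>\<close>, linearity of \<open>X \<omega>\<close> gives linearity of \<open>e \<mapsto> [X(e)]\<close>, and
  \<open>x\<^sub>n \<longlonglongrightarrow> l\<close> gives \<open>X \<omega> (x\<^sub>n) \<longlonglongrightarrow> X \<omega> l\<close>; passing to other representatives costs countably
  many null sets, whence almost sure convergence (\<open>kappa_class_in_Lin_path\<close>). Almost sure
  convergence implies convergence in probability, so path continuous maps are continuous into
  \<open>L0 M\<close> (\<open>Lin_path_subset_Lin_c\<close>), and both codomains are settled.

  Injectivity is where separability enters. If \<open>X\<close> and \<open>Y\<close> have the same image, then for each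
  \<open>e\<close> they agree at \<open>e\<close> almost surely, with a null set depending on \<open>e\<close>. On a countable
  sequentially dense set these null sets can be merged into one. Off it, \<open>X \<omega>\<close> and \<open>Y \<omega>\<close> are
  sequentially continuous functionals that agree on the dense set, so they are equal everywhere
  (\<open>seq_dual_eqI\<close>). This is strict equivalence.\<close>

text \<open>Along a sequence of \<open>D\<close> converging to \<open>x\<close> the two functionals take the same values, and
  \<open>S x\<close> and \<open>T x\<close> are both the limit of these reals.\<close>

lemma seq_dual_eqI:
  assumes "S \<in> seq_dual" "T \<in> seq_dual"
    and dense: "\<And>x. \<exists>d :: nat \<Rightarrow> 'e::locally_convex_space. range d \<subseteq> D \<and> d \<longlonglongrightarrow> x"
    and eq: "\<And>x. x \<in> D \<Longrightarrow> S x = T x"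
  shows "S = T"
proof
  fix x
  obtain d :: "nat \<Rightarrow> 'e" where d: "range d \<subseteq> D" "d \<longlonglongrightarrow> x"
    using dense by blast
  have "(\<lambda>n. S (d n)) \<longlonglongrightarrow> S x" "(\<lambda>n. T (d n)) \<longlonglongrightarrow> T x"
    using assms(1,2) d(2) by (auto simp: seq_dual_def)
  moreover have "(\<lambda>n. S (d n)) = (\<lambda>n. T (d n))"
    using d(1) eq by auto
  ultimately show "S x = T x"
    using LIMSEQ_unique by metis
qed

text \<open>The probabilities are integrals of indicators that are bounded by 1 and almost surely vanish
  from some index on, so dominated convergence applies.\<close>

lemma (in prob_space) AE_tendsto_imp_tendsto_prob:
  fixes f :: "nat \<Rightarrow> 'a \<Rightarrow> real"
  assumes [measurable]: "\<And>n. f n \<in> borel_measurable M" "g \<in> borel_measurable M"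
    and lim: "AE \<omega> in M. (\<lambda>n. f n \<omega>) \<longlonglongrightarrow> g \<omega>"
    and "\<epsilon> > 0"
  shows "(\<lambda>n. prob {\<omega> \<in> space M. \<epsilon> < \<bar>f n \<omega> - g \<omega>\<bar>}) \<longlonglongrightarrow> 0"
proof -
  define A where "A n = {\<omega> \<in> space M. \<epsilon> < \<bar>f n \<omega> - g \<omega>\<bar>}" for n
  have [measurable]: "A n \<in> sets M" for n
    unfolding A_def by measurable
  have "(\<lambda>n. \<integral>\<omega>. indicator (A n) \<omega> \<partial>M) \<longlonglongrightarrow> (\<integral>\<omega>. (0::real) \<partial>M)"
  proof (rule integral_dominated_convergence[where w = "\<lambda>_. 1"])
    show "AE \<omega> in M. (\<lambda>n. indicator (A n) \<omega> :: real) \<longlonglongrightarrow> 0"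
      using lim
    proof eventually_elim
      case (elim \<omega>)
      have "\<forall>\<^sub>F n in sequentially. dist (f n \<omega>) (g \<omega>) < \<epsilon>"
        using elim \<open>\<epsilon> > 0\<close> by (rule tendstoD)
      then have "\<forall>\<^sub>F n in sequentially. indicator (A n) \<omega> = (0::real)"
        by eventually_elim (auto simp: A_def dist_real_def)
      then show ?case
        by (rule tendsto_eventually)
    qed
  qed (auto simp: indicator_def)
  then show ?thesis
    by (simp add: A_def[symmetric])
qed

lemma (in prob_space) Lin_path_subset_Lin_c: "Lin_path M \<subseteq> Lin_c M"
proof
  fix Y :: "'e::locally_convex_space \<Rightarrow> ('a \<Rightarrow> real) set"
  assume Y: "Y \<in> Lin_path M"
  have "\<exists>f. f \<in> borel_measurable M \<and> Y e = L0_class M f" for e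
  proof -
    have "Y e \<in> L0 M"
      using Y by (simp add: Lin_path_def L0_linear_def)
    then show ?thesis
      by (rule L0_classE) (intro exI conjI)
  qed
  then obtain r where r: "\<And>e. r e \<in> borel_measurable M" "\<And>e. Y e = L0_class M (r e)"
    by metis
  have "limitin (L0_topology M) (\<lambda>n. Y (x n)) (Y l) sequentially" if "x \<longlonglongrightarrow> l" for x l
  proof -
    have "L0_tendsto_AE M (\<lambda>n. Y (x n)) (Y l)"
      using Y that by (auto simp: Lin_path_def)
    then have "AE \<omega> in M. (\<lambda>n. r (x n) \<omega>) \<longlonglongrightarrow> r l \<omega>"
      unfolding L0_tendsto_AE_def r(2) using self_in_L0_class[OF r(1)]
      by (elim allE[of _ "\<lambda>n. r (x n)"] allE[of _ "r l"]) simp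
    then show ?thesis
      unfolding r(2) limitin_L0_topology_iff[OF r(1) r(1)]
      using AE_tendsto_imp_tendsto_prob[OF r(1) r(1)] by blast
  qed
  then show "Y \<in> Lin_c M"
    using Y by (simp add: Lin_path_def Lin_c_def)
qed

lemma (in prob_space) kappa_class_in_Lin_path:
  fixes X :: "'a \<Rightarrow> 'e::locally_convex_space \<Rightarrow> real"
  assumes X: "X \<in> M \<rightarrow>\<^sub>M seq_dual_measure"
  shows "(\<lambda>e. L0_class M (\<lambda>\<omega>. X \<omega> e)) \<in> Lin_path M"
proof -
  have meas: "(\<lambda>\<omega>. X \<omega> e) \<in> borel_measurable M" for e
    using X by (simp add: measurable_seq_dual_measure_iff)
  have dual: "X \<omega> \<in> seq_dual" if "\<omega> \<in> space M" for \<omega>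
    using X that by (simp add: measurable_seq_dual_measure_iff)
  then have lin: "linear (X \<omega>)" if "\<omega> \<in> space M" for \<omega>
    using that by (auto simp: seq_dual_def)
  have "L0_linear M (\<lambda>e. L0_class M (\<lambda>\<omega>. X \<omega> e))"
    unfolding L0_linear_def
  proof (intro conjI allI)
    show "L0_class M (\<lambda>\<omega>. X \<omega> x) \<in> L0 M" for x
      by (rule L0_class_in_L0[OF meas])
    show "L0_class M (\<lambda>\<omega>. X \<omega> (x + y)) =
        L0_add M (L0_class M (\<lambda>\<omega>. X \<omega> x)) (L0_class M (\<lambda>\<omega>. X \<omega> y))" for x y
      using meas lin
      by (auto simp: L0_add_class L0_class_eq_iff linear_add)
    show "L0_class M (\<lambda>\<omega>. X \<omega> (c *\<^sub>R x)) = L0_scale M c (L0_class M (\<lambda>\<omega>. X \<omega> x))" for c x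
      using meas lin
      by (auto simp: L0_scale_class L0_class_eq_iff linear_scale)
  qed
  moreover have "L0_tendsto_AE M (\<lambda>n. L0_class M (\<lambda>\<omega>. X \<omega> (x n))) (L0_class M (\<lambda>\<omega>. X \<omega> l))"
    if "x \<longlonglongrightarrow> l" for x l
    unfolding L0_tendsto_AE_def
  proof (intro allI impI)
    fix f g
    assume "\<forall>n. f n \<in> L0_class M (\<lambda>\<omega>. X \<omega> (x n))" "g \<in> L0_class M (\<lambda>\<omega>. X \<omega> l)"
    then have "AE \<omega> in M. \<forall>n. X \<omega> (x n) = f n \<omega>" "AE \<omega> in M. X \<omega> l = g \<omega>"
      by (auto simp: mem_L0_class AE_all_countable)
    then show "AE \<omega> in M. (\<lambda>n. f n \<omega>) \<longlonglongrightarrow> g \<omega>"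
      using AE_space
    proof eventually_elim
      case (elim \<omega>)
      then have "(\<lambda>n. X \<omega> (x n)) \<longlonglongrightarrow> X \<omega> l"
        using dual[of \<omega>] \<open>x \<longlonglongrightarrow> l\<close> unfolding seq_dual_def by blast
      then show ?case
        using elim by simp
    qed
  qed
  ultimately show ?thesis
    by (simp add: Lin_path_def)
qed

lemma (in prob_space) kappa_in_Lin_path: "kappa M \<in> L0_dual M \<rightarrow> Lin_path M"
proof
  fix C :: "('a \<Rightarrow> 'e::locally_convex_space \<Rightarrow> real) set"
  assume "C \<in> L0_dual M"
  then obtain X where "X \<in> M \<rightarrow>\<^sub>M seq_dual_measure" "C = strict_rel M `` {X}"
    unfolding L0_dual_def by (rule quotientE)
  then show "kappa M C \<in> Lin_path M"
    by (simp add: kappa_class kappa_class_in_Lin_path)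
qed

text \<open>The null set where \<open>X \<omega> e \<noteq> Y \<omega> e\<close> may vary with \<open>e\<close>. The witness for strict equivalence is
  the event \<open>S\<close> of agreement on a countable sequentially dense set, which is measurable and has
  probability 1 by countability, and on which \<open>X\<close> and \<open>Y\<close> agree as functionals by density.\<close>

lemma (in prob_space) strict_rel_if_AE_eq:
  fixes X Y :: "'a \<Rightarrow> 'e::locally_convex_space \<Rightarrow> real"
  assumes sep: "sequentially_separable TYPE('e)"
    and X: "X \<in> M \<rightarrow>\<^sub>M seq_dual_measure" and Y: "Y \<in> M \<rightarrow>\<^sub>M seq_dual_measure"
    and AE_eq: "\<And>e. AE \<omega> in M. X \<omega> e = Y \<omega> e"
  shows "(X, Y) \<in> strict_rel M"
proof -
  obtain D :: "'e set" where D: "countable D"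
    and dense: "\<And>x. \<exists>d :: nat \<Rightarrow> 'e. range d \<subseteq> D \<and> d \<longlonglongrightarrow> x"
    using sep unfolding sequentially_separable_def by blast
  define S where "S = {\<omega> \<in> space M. \<forall>e\<in>D. X \<omega> e = Y \<omega> e}"
  have [measurable]: "(\<lambda>\<omega>. X \<omega> e) \<in> borel_measurable M" "(\<lambda>\<omega>. Y \<omega> e) \<in> borel_measurable M" for e
    using X Y by (auto simp: measurable_seq_dual_measure_iff)
  have S: "S \<in> sets M"
    unfolding S_def using D by measurable
  have "AE \<omega> in M. \<forall>e\<in>D. X \<omega> e = Y \<omega> e"
    using D AE_eq by (simp add: AE_ball_countable)
  then have "AE \<omega> in M. \<omega> \<in> S"
    using AE_space by eventually_elim (simp add: S_def)
  then have "prob S = 1"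
    using S by (simp add: prob_eq_1)
  moreover have "X \<omega> = Y \<omega>" if "\<omega> \<in> S" for \<omega>
  proof (rule seq_dual_eqI[OF _ _ dense])
    show "X \<omega> \<in> seq_dual" "Y \<omega> \<in> seq_dual"
      using X Y that by (auto simp: S_def measurable_seq_dual_measure_iff)
    show "X \<omega> e = Y \<omega> e" if "e \<in> D" for e
      using that \<open>\<omega> \<in> S\<close> by (simp add: S_def)
  qed
  ultimately show ?thesis
    using S X Y by (auto simp: strict_rel_def)
qed

lemma (in prob_space) inj_on_kappa:
  assumes "sequentially_separable TYPE('e::locally_convex_space)"
  shows "inj_on (kappa M) (L0_dual M :: ('a \<Rightarrow> 'e \<Rightarrow> real) set set)"
proof (rule inj_onI)
  fix A B :: "('a \<Rightarrow> 'e \<Rightarrow> real) set"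
  assume "A \<in> L0_dual M" "B \<in> L0_dual M" and eq: "kappa M A = kappa M B"
  then obtain X Y where X: "X \<in> M \<rightarrow>\<^sub>M seq_dual_measure" "A = strict_rel M `` {X}"
    and Y: "Y \<in> M \<rightarrow>\<^sub>M seq_dual_measure" "B = strict_rel M `` {Y}"
    unfolding L0_dual_def by (metis quotientE)
  have "AE \<omega> in M. X \<omega> e = Y \<omega> e" for e
  proof -
    have "L0_class M (\<lambda>\<omega>. X \<omega> e) = L0_class M (\<lambda>\<omega>. Y \<omega> e)"
      using fun_cong[OF eq, of e] X Y by (simp add: kappa_class)
    then show ?thesis
      using X Y by (simp add: L0_class_eq_iff measurable_seq_dual_measure_iff)
  qed
  then have "(X, Y) \<in> strict_rel M"
    using assms X Y by (intro strict_rel_if_AE_eq)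
  then show "A = B"
    using X Y equiv_class_eq[OF equiv_strict_rel] by simp
qed

theorem proposition5p4:
  fixes M :: "'w measure"
  assumes "prob_space M"
    and "sequentially_separable TYPE('e::locally_convex_space)"
  shows "(kappa M \<in> L0_dual M \<rightarrow> (Lin_c M :: ('e \<Rightarrow> ('w \<Rightarrow> real) set) set)
            \<and> inj_on (kappa M) (L0_dual M :: ('w \<Rightarrow> 'e \<Rightarrow> real) set set))
       \<and> (kappa M \<in> L0_dual M \<rightarrow> (Lin_path M :: ('e \<Rightarrow> ('w \<Rightarrow> real) set) set)
            \<and> inj_on (kappa M) (L0_dual M :: ('w \<Rightarrow> 'e \<Rightarrow> real) set set))"
proof -
  interpret prob_space M by fact
  show ?thesis
  proof (intro conjI)
    show "kappa M \<in> L0_dual M \<rightarrow> (Lin_path M :: ('e \<Rightarrow> ('w \<Rightarrow> real) set) set)"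
      by (rule kappa_in_Lin_path)
    then show "kappa M \<in> L0_dual M \<rightarrow> (Lin_c M :: ('e \<Rightarrow> ('w \<Rightarrow> real) set) set)"
      using Lin_path_subset_Lin_c by blast
  qed (rule inj_on_kappa[OF assms(2)])+
qed

end
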